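(* For an integer $n\geq 2$, let $\pi_n$ denote the probability that, if two $n$-cycles $u,v$ are chosen independently and uniformly at random from the symmetric group $\mathfrak{S}_n$ of permutations of $\{1,2,\dots,n\}$, then $1$ and $2$ lie in the same cycle of the product $uv$. Then $$\pi_n=\begin{cases}\frac12, & n \text{ odd},\\[.3em] \frac12-\frac{2}{(n-1)(n+2)}, & n\text{ even}.\end{cases}$$
   Context: An $n$-cycle in $\mathfrak{S}_n$ is a permutation consisting of a single cycle of length $n$. *)

theory Defs
  imports "HOL-Probability.Probability" "HOL-Combinatorics.Orbits"
begin

definition n_cycles :: "nat \<Rightarrow> (nat \<Rightarrow> nat) set" where
  "n_cycles n = {p. p permutes {1..n} \<and> cyclic_on p {1..n}}"

text \<open>
  The next two lemmas are what makes \<^term>\<open>pmf_of_set (n_cycles n)\<close> the genuine uniform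
  distribution (on an empty or infinite set \<^const>\<open>pmf_of_set\<close> is unspecified).
\<close>

lemma finite_n_cycles: "finite (n_cycles n)"
  unfolding n_cycles_def by (rule finite_subset[OF _ finite_permutations[of "{1..n}"]]) auto

lemma n_cycles_nonempty:
  assumes "n \<ge> 1"
  shows "n_cycles n \<noteq> {}"
proof -
  define p where "p = (\<lambda>i::nat. if i \<in> {1..n} then (if i = n then 1 else i + 1) else i)"
  have "inj_on p {1..n}"
    by (auto simp: inj_on_def p_def split: if_splits)
  moreover have "p ` {1..n} \<subseteq> {1..n}"
    by (auto simp: p_def)
  ultimately have "bij_betw p {1..n} {1..n}"
    by (simp add: bij_betw_def endo_inj_surj)
  then have perm: "p permutes {1..n}"
    by (rule bij_imp_permutes) (auto simp: p_def)
  have one: "1 \<in> orbit p 1"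
    using perm by (intro permutation_self_in_orbit) (auto simp: permutation_permutes)
  have "i \<in> orbit p 1" if "i \<in> {1..n}" for i
    using that
  proof (induction i)
    case (Suc i)
    show ?case
    proof (cases "i = 0")
      case False
      with Suc have "i \<in> orbit p 1" by simp
      then have "p i \<in> orbit p 1" by (rule orbit.step)
      moreover have "p i = Suc i"
        using Suc.prems False by (simp add: p_def)
      ultimately have "Suc i \<in> orbit p 1" by simp
      then show ?thesis by simp
    qed (use one in simp)
  qed simp
  moreover have "orbit p 1 \<subseteq> {1..n}"
    using assms by (intro permutes_orbit_subset[OF perm]) auto
  ultimately have "cyclic_on p {1..n}"
    using assms by (auto simp: cyclic_on_def intro!: bexI[of _ 1])
  with perm show ?thesis by (auto simp: n_cycles_def)
qed

text \<open>
  For a permutation \<open>p\<close> of a finite set, \<^term>\<open>orbit p x\<close> is the cycle of \<open>p\<close> through \<open>x\<close>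
  (fixed points being cycles of length 1). The product \<open>u v\<close> is \<open>u \<circ> v\<close>; the other convention
  gives the same probability, since \<open>u\<close> and \<open>v\<close> are independent and identically distributed.
\<close>

definition cycle_product_prob :: "nat \<Rightarrow> real" where
  "cycle_product_prob n =
     measure_pmf.prob (pair_pmf (pmf_of_set (n_cycles n)) (pmf_of_set (n_cycles n)))
       {(u, v). 2 \<in> orbit (u \<circ> v) 1}"

end

theory Submission
  imports Defs "HOL-Computational_Algebra.Polynomial"
begin

text \<open>
  Let \<open>\<tau> = (1 2)\<close>. Multiplying a permutation by \<open>\<tau>\<close> raises its number of cycles by one if 1 and 2
  lie in the same cycle, and lowers it by one otherwise. Hence \<open>2 \<pi>\<^sub>n - 1\<close> is the expected difference
  between the numbers of cycles of \<open>\<tau> u v\<close> and of \<open>u v\<close>. For a fixed permutation \<open>p\<close> with cycle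
  lengths \<open>\<lambda>\<^sub>1, \<lambda>\<^sub>2, \<dots>\<close> and a uniformly random full cycle \<open>u\<close>, the expected number of cycles of
  \<open>u p\<close> is
  \<open>\<integral>\<^sub>0\<^sup>1 (1 - (1 - x) \<Prod>\<^sub>j ((1 - x)^\<lambda>\<^sub>j - (- x)^\<lambda>\<^sub>j)) / x dx\<close>.
  This follows by induction on the number of points: writing \<open>u = u' (z j)\<close> with a full cycle \<open>u'\<close> on
  the points other than \<open>z\<close>, one deletes \<open>z\<close> from \<open>(z j) p\<close>, which splits the cycle of \<open>z\<close> or merges
  it with another one. Finally, \<open>u\<close> has the single cycle length \<open>n\<close>, while those of \<open>\<tau> u\<close> are
  \<open>k\<close> and \<open>n - k\<close> with \<open>k\<close> uniform in \<open>{1..<n}\<close>, and the integrals can be evaluated.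
\<close>

section \<open>Transpositions acting on the cycles of a permutation\<close>

definition cycles :: "('a \<Rightarrow> 'a) \<Rightarrow> 'a set \<Rightarrow> 'a set set" where
  "cycles p S = orbit p ` S"

lemma finite_cycles [simp]: "finite S \<Longrightarrow> finite (cycles p S)"
  by (simp add: cycles_def)

lemma orbit_eq_if_mem:
  assumes "permutation p" "y \<in> orbit p x"
  shows "orbit p y = orbit p x"
  using orbit_cyclic_eq3[OF cyclic_on_orbit'[OF assms(1)] assms(2)] .

lemma orbit_enum:
  assumes "permutation p"
  shows "inj_on (\<lambda>i. (p ^^ i) a) {..<card (orbit p a)}"
    and "orbit p a = (\<lambda>i. (p ^^ i) a) ` {..<card (orbit p a)}"
    and "(p ^^ card (orbit p a)) a = a"
proof -
  have a: "a \<in> orbit p a" using assms by (rule permutation_self_in_orbit)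
  let ?d = "funpow_dist1 p a a"
  have inj: "inj_on (\<lambda>i. (p ^^ i) a) {..<?d}"
    using inj_on_funpow_dist1[OF a] by (simp add: atLeast0LessThan)
  have im: "orbit p a = (\<lambda>i. (p ^^ i) a) ` {..<?d}"
    using orbit_conv_funpow_dist1[OF a] by (simp add: atLeast0LessThan)
  have "card (orbit p a) = ?d"
    by (subst im) (simp add: card_image[OF inj])
  then show "inj_on (\<lambda>i. (p ^^ i) a) {..<card (orbit p a)}"
    "orbit p a = (\<lambda>i. (p ^^ i) a) ` {..<card (orbit p a)}"
    "(p ^^ card (orbit p a)) a = a"
    using inj im funpow_dist1_prop[OF a] by simp_all
qed

text \<open>Reads an orbit off an explicit run that returns to its start. Any positive return time
  \<open>m\<close> will do, so minimality never has to be proved.\<close>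

lemma orbit_segment:
  assumes "\<And>i. i < m \<Longrightarrow> (q ^^ i) a = f i" "(q ^^ m) a = a" "0 < m"
  shows "orbit q a = f ` {..<m}"
proof -
  have "orbit q a = (\<lambda>i. (q ^^ i) a) ` {..<m}"
    using orbit_altdef_bounded[OF assms(2,3)] by auto
  also have "\<dots> = f ` {..<m}" using assms(1) by (intro image_cong) auto
  finally show ?thesis .
qed

lemma permutation_transpose_comp: "permutation p \<Longrightarrow> permutation (Transposition.transpose a b \<circ> p)"
  by (simp add: permutation_compose permutation_swap_id)

text \<open>Composing with the transposition changes \<open>p\<close> only at the predecessors of
  \<open>a\<close> and \<open>b\<close>: the predecessor of \<open>b\<close> is now sent to
  \<open>a\<close>, and that of \<open>a\<close> to \<open>b\<close>. The run \<open>a\<close>,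
  \<open>p a\<close>, ... is thus cut at index \<open>k\<close>, and each piece closes up.\<close>

lemma transpose_split:
  assumes p: "permutation p" and k: "0 < k" "k < card (orbit p a)" and b: "b = (p ^^ k) a"
  defines "q \<equiv> Transposition.transpose a b \<circ> p"
  shows "orbit q a = (\<lambda>i. (p ^^ i) a) ` {..<k}"
    and "orbit q b = (\<lambda>i. (p ^^ i) a) ` {k..<card (orbit p a)}"
    and "x \<notin> orbit p a \<Longrightarrow> orbit q x = orbit p x"
proof -
  let ?l = "card (orbit p a)"
  note inj = orbit_enum(1)[OF p, of a] and im = orbit_enum(2)[OF p, of a]
    and l = orbit_enum(3)[OF p, of a]
  have ne: "(p ^^ i) a \<noteq> (p ^^ j) a" if "i < ?l" "j < ?l" "i \<noteq> j" for i j
    using inj that by (auto simp: inj_on_def)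
  \<comment> \<open>Under these bounds the next point is neither \<open>a\<close> (index 0) nor
    \<open>b\<close> (index \<open>k\<close>), so the transposition leaves it alone.\<close>
  have q: "q ((p ^^ i) a) = (p ^^ Suc i) a" if "Suc i < ?l" "Suc i \<noteq> k" for i
    using ne[of "Suc i" 0] ne[of "Suc i" k] that k b by (simp add: q_def)
  have qa: "(q ^^ i) a = (p ^^ i) a" if "i < k" for i
    using that by (induction i) (use q k in auto)
  have "(q ^^ k) a = a"
  proof -
    obtain k' where k': "k = Suc k'" using k(1) by (cases k) auto
    have "(q ^^ k) a = q ((p ^^ k') a)" using qa[of k'] k' by simp
    also have "\<dots> = a" using b k' by (simp add: q_def)
    finally show ?thesis .
  qed
  with qa k(1) show "orbit q a = (\<lambda>i. (p ^^ i) a) ` {..<k}"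
    by (intro orbit_segment) auto
  have qb: "(q ^^ i) b = (p ^^ (k + i)) a" if "i < ?l - k" for i
    using that
  proof (induction i)
    case 0 then show ?case by (simp add: b)
  next
    case (Suc i)
    then show ?case using q[of "k + i"] by simp
  qed
  have "(q ^^ (?l - k)) b = b"
  proof -
    obtain l' where l': "?l = Suc l'" using k by (cases ?l) auto
    have "(q ^^ (?l - k)) b = q ((q ^^ (l' - k)) b)" using l' k by (simp add: Suc_diff_le)
    also have "\<dots> = q ((p ^^ l') a)" using qb[of "l' - k"] l' k by simp
    also have "p ((p ^^ l') a) = a" using l l' by simp
    then have "q ((p ^^ l') a) = b" by (simp add: q_def)
    finally show ?thesis .
  qed
  then have "orbit q b = (\<lambda>i. (p ^^ (k + i)) a) ` {..<?l - k}"
    using qb k by (intro orbit_segment) auto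
  also have "\<dots> = (\<lambda>i. (p ^^ i) a) ` ((+) k ` {..<?l - k})"
    by (simp add: image_image)
  also have "(+) k ` {..<?l - k} = {k..<?l}"
    using k by (simp add: lessThan_atLeast0 add.commute)
  finally show "orbit q b = (\<lambda>i. (p ^^ i) a) ` {k..<card (orbit p a)}" .
  show "orbit q x = orbit p x" if x: "x \<notin> orbit p a"
  proof (rule orbit_cong[OF permutation_self_in_orbit[OF p]])
    fix s assume "s \<in> orbit p x"
    then have "p s \<in> orbit p x" by (rule orbit.step)
    then have "orbit p (p s) = orbit p x" using p by (intro orbit_eq_if_mem)
    moreover have "a \<in> orbit p a" "b \<in> orbit p a"
      using permutation_self_in_orbit[OF p] by (auto simp: b funpow_in_orbit)
    then have "orbit p b = orbit p a" using p by (intro orbit_eq_if_mem)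
    moreover have "x \<in> orbit p x" using p by (rule permutation_self_in_orbit)
    ultimately have "p s \<noteq> a" "p s \<noteq> b" using x by metis+
    then show "q s = p s" by (simp add: q_def)
  qed
qed

lemma transpose_split_disjoint:
  assumes p: "permutation p" and k: "0 < k" "k < card (orbit p a)" and b: "b = (p ^^ k) a"
  defines "q \<equiv> Transposition.transpose a b \<circ> p"
  shows "orbit q a \<inter> orbit q b = {}" "orbit q a \<union> orbit q b = orbit p a"
    "card (orbit q a) = k" "card (orbit q b) = card (orbit p a) - k"
proof -
  let ?l = "card (orbit p a)"
  note eq = transpose_split(1,2)[OF p k b, folded q_def]
  note inj = orbit_enum(1)[OF p, of a] and im = orbit_enum(2)[OF p, of a]
  have "(\<lambda>i. (p ^^ i) a) ` {..<k} \<inter> (\<lambda>i. (p ^^ i) a) ` {k..<?l} =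
      (\<lambda>i. (p ^^ i) a) ` ({..<k} \<inter> {k..<?l})"
    using k by (intro inj_on_image_Int[OF inj, symmetric]) auto
  then show "orbit q a \<inter> orbit q b = {}"
    unfolding eq by auto
  have "{..<k} \<union> {k..<?l} = {..<?l}" using k by auto
  then have "(\<lambda>i. (p ^^ i) a) ` {..<k} \<union> (\<lambda>i. (p ^^ i) a) ` {k..<?l} =
      (\<lambda>i. (p ^^ i) a) ` {..<?l}"
    by (simp only: image_Un[symmetric])
  then show "orbit q a \<union> orbit q b = orbit p a"
    by (simp only: eq im[symmetric])
  show "card (orbit q a) = k"
    unfolding eq using k by (subst card_image) (auto intro: inj_on_subset[OF inj])
  show "card (orbit q b) = card (orbit p a) - k"
    unfolding eq using k by (subst card_image) (auto intro: inj_on_subset[OF inj])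
qed

lemma orbit_power_index:
  assumes "permutation p" "b \<in> orbit p a" "b \<noteq> a"
  obtains k where "0 < k" "k < card (orbit p a)" "b = (p ^^ k) a"
proof -
  obtain k where "k < card (orbit p a)" "b = (p ^^ k) a"
    using assms(2) orbit_enum(2)[OF assms(1), of a] by auto
  moreover from this have "0 < k" using assms(3) by (cases k) auto
  ultimately show ?thesis using that by blast
qed

text \<open>The new permutation follows the \<open>p\<close>-cycle of \<open>a\<close> up to its
  last point, whose image \<open>a\<close> has been replaced by \<open>b\<close>.\<close>

lemma transpose_merge_mem:
  assumes p: "permutation p" and b: "b \<notin> orbit p a"
  shows "b \<in> orbit (Transposition.transpose a b \<circ> p) a"
proof -
  define q where "q = Transposition.transpose a b \<circ> p"
  let ?l = "card (orbit p a)"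
  note inj = orbit_enum(1)[OF p, of a] and im = orbit_enum(2)[OF p, of a]
    and l = orbit_enum(3)[OF p, of a]
  have a: "a \<in> orbit p a" using p by (rule permutation_self_in_orbit)
  have l0: "0 < ?l" using im a by (cases ?l) auto
  have eq: "(q ^^ i) a = (p ^^ i) a" if "i < ?l" for i
    using that
  proof (induction i)
    case (Suc i)
    have "(p ^^ Suc i) a \<noteq> a"
      using inj_onD[OF inj, of "Suc i" 0] Suc.prems by auto
    moreover have "(p ^^ Suc i) a \<noteq> b" using b funpow_in_orbit[OF a] by metis
    ultimately show ?case using Suc by (simp add: q_def)
  qed simp
  obtain l' where l': "?l = Suc l'" using l0 by (cases ?l) auto
  have "(q ^^ ?l) a = b"
    using eq[of l'] l l' by (simp add: q_def)
  with l0 have "\<exists>n. b = (q ^^ n) a \<and> 0 < n" by (intro exI[of _ ?l]) simp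
  then have "b \<in> orbit q a" by (simp only: orbit_altdef mem_Collect_eq)
  then show ?thesis by (simp add: q_def)
qed

context
  fixes p :: "'a \<Rightarrow> 'a" and S :: "'a set"
  assumes p: "p permutes S" and S: "finite S"
begin

lemma permutation_if_permutes_finite: "permutation p"
  using S p by (rule permutes_imp_permutation)

lemma mem_cycles_iff: "c \<in> cycles p S \<and> x \<in> c \<longleftrightarrow> x \<in> S \<and> c = orbit p x"
proof
  assume "c \<in> cycles p S \<and> x \<in> c"
  then obtain y where y: "y \<in> S" "c = orbit p y" "x \<in> orbit p y" unfolding cycles_def by blast
  show "x \<in> S \<and> c = orbit p x"
  proof
    show "x \<in> S" using permutes_orbit_subset[OF p y(1)] y(3) by blast
    show "c = orbit p x" using orbit_eq_if_mem[OF permutation_if_permutes_finite y(3)] y(2) by simp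
  qed
next
  assume "x \<in> S \<and> c = orbit p x"
  then show "c \<in> cycles p S \<and> x \<in> c"
    using permutation_self_in_orbit[OF permutation_if_permutes_finite] unfolding cycles_def by blast
qed

lemma sum_card_cycles: "(\<Sum>c\<in>cycles p S. card c) = card S"
proof -
  have "card (\<Union>(cycles p S)) = (\<Sum>c\<in>cycles p S. card c)"
  proof (rule card_Union_disjoint)
    show "pairwise disjnt (cycles p S)"
    proof (intro pairwiseI)
      fix c d assume "c \<in> cycles p S" "d \<in> cycles p S" "c \<noteq> d"
      then show "disjnt c d"
        using mem_cycles_iff[of c] mem_cycles_iff[of d] by (auto simp: disjnt_iff)
    qed
    show "finite A" if "A \<in> cycles p S" for A
      using that permutation_self_in_orbit[OF permutation_if_permutes_finite] by (auto simp: cycles_def intro: finite_orbit)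
  qed
  moreover have "\<Union>(cycles p S) = S"
    using permutes_orbit_subset[OF p] permutation_self_in_orbit[OF permutation_if_permutes_finite]
    by (auto simp: cycles_def)
  ultimately show ?thesis by simp
qed

text \<open>An old cycle that contains \<open>a\<close> or \<open>b\<close> is all of
  \<open>orbit p a\<close> and contains both, whereas the new orbits separate them; hence both new
  orbits are really new. The inequalities are what makes counts and products over
  \<open>cycles q S\<close> computable.\<close>

lemma cycles_transpose_split:
  assumes a: "a \<in> S" and k: "0 < k" "k < card (orbit p a)" and b: "b = (p ^^ k) a"
  defines "q \<equiv> Transposition.transpose a b \<circ> p"
  shows "cycles q S = insert (orbit q a) (insert (orbit q b) (cycles p S - {orbit p a}))"
    and "orbit q a \<noteq> orbit q b" "orbit q a \<notin> cycles p S" "orbit q b \<notin> cycles p S"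
proof -
  note d = transpose_split_disjoint[OF permutation_if_permutes_finite k b, folded q_def]
  note o = transpose_split(3)[OF permutation_if_permutes_finite k b, folded q_def]
  have ne: "orbit q a \<noteq> {}" "orbit q b \<noteq> {}" by (rule orbit_nonempty)+
  then show "orbit q a \<noteq> orbit q b" using d(1) by blast
  have q: "permutation q" unfolding q_def using permutation_if_permutes_finite by (rule permutation_transpose_comp)
  have "orbit p x = orbit p a" if "x \<in> orbit p a" for x
    using that by (rule orbit_eq_if_mem[OF permutation_if_permutes_finite])
  then have eq: "c = orbit p a" if "c \<in> cycles p S" "x \<in> c" "x \<in> orbit p a" for c x
    using that mem_cycles_iff by metis
  have "a \<in> orbit q a" "b \<in> orbit q b" using q by (rule permutation_self_in_orbit)+
  then show "orbit q a \<notin> cycles p S" "orbit q b \<notin> cycles p S"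
    using d(1,2) eq[of _ a] eq[of _ b] by blast+
  have bS: "b \<in> S" using a permutes_in_funpow_image[OF p a] b by simp
  have 1: "orbit q x \<in> {orbit q a, orbit q b}" if "x \<in> orbit p a" for x
    using that d(2) orbit_eq_if_mem[OF q] by blast
  show "cycles q S = insert (orbit q a) (insert (orbit q b) (cycles p S - {orbit p a}))"
    (is "?L = ?R")
  proof
    show "?L \<subseteq> ?R"
    proof
      fix c assume "c \<in> ?L"
      then obtain x where x: "x \<in> S" "c = orbit q x" by (auto simp: cycles_def)
      show "c \<in> ?R"
      proof (cases "x \<in> orbit p a")
        case False
        then have "c = orbit p x" using o x by simp
        moreover have "orbit p x \<noteq> orbit p a"
          using False permutation_self_in_orbit[OF permutation_if_permutes_finite, of x] by auto
        ultimately show ?thesis using x by (auto simp: cycles_def)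
      qed (use 1 x in blast)
    qed
    show "?R \<subseteq> ?L"
    proof
      fix c assume "c \<in> ?R"
      then consider "c = orbit q a" | "c = orbit q b" | x where "x \<in> S" "c = orbit p x" "c \<noteq> orbit p a"
        by (auto simp: cycles_def)
      then show "c \<in> ?L"
      proof cases
        case 3
        then have "x \<notin> orbit p a" using orbit_eq_if_mem[OF permutation_if_permutes_finite] by blast
        then have "c = orbit q x" using o 3 by simp
        then show ?thesis using 3 by (simp add: cycles_def)
      qed (use a bS in \<open>auto simp: cycles_def\<close>)
    qed
  qed
qed

end

text \<open>Merging is splitting read backwards: the transposition is an involution, so applying it
  to \<open>q\<close> gives \<open>p\<close> back, and \<open>b\<close> lies in the
  \<open>q\<close>-orbit of \<open>a\<close>.\<close>

lemma cycles_transpose_merge: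
  assumes p: "p permutes S" and S: "finite S" and a: "a \<in> S" and b: "b \<in> S" "b \<notin> orbit p a"
  defines "q \<equiv> Transposition.transpose a b \<circ> p"
  shows "cycles q S - {orbit q a} = cycles p S - {orbit p a, orbit p b}"
    and "orbit q a = orbit p a \<union> orbit p b"
    and "card (orbit q a) = card (orbit p a) + card (orbit p b)"
    and "orbit p a \<noteq> orbit p b"
    and "card (cycles p S) = Suc (card (cycles q S))"
proof -
  have pp: "permutation p" using S p by (rule permutes_imp_permutation)
  have "b \<noteq> a" using b permutation_self_in_orbit[OF pp] by auto
  moreover have "b \<in> orbit q a" using transpose_merge_mem[OF pp b(2)] by (simp add: q_def)
  moreover have q: "q permutes S" unfolding q_def
    using a b p by (intro permutes_compose permutes_swap_id)
  have pq: "permutation q" using S q by (rule permutes_imp_permutation)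
  ultimately obtain k where k: "0 < k" "k < card (orbit q a)" "b = (q ^^ k) a"
    using orbit_power_index by metis
  have tq: "Transposition.transpose a b \<circ> q = p" by (simp add: q_def comp_assoc[symmetric])
  note s = cycles_transpose_split[OF q S a k, unfolded tq]
  note d = transpose_split_disjoint[OF pq k, unfolded tq]
  show "orbit q a = orbit p a \<union> orbit p b" "card (orbit q a) = card (orbit p a) + card (orbit p b)"
    "orbit p a \<noteq> orbit p b"
    using d s k by auto
  show "cycles q S - {orbit q a} = cycles p S - {orbit p a, orbit p b}"
    using s by auto
  have "orbit q a \<in> cycles q S" using a by (auto simp: cycles_def)
  then have "card (cycles q S) = Suc (card (cycles q S - {orbit q a}))"
    using S by (intro card.remove) auto
  moreover have "card (cycles p S) = Suc (Suc (card (cycles q S - {orbit q a})))"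
    unfolding s(1) using s(2-) S by (auto simp: card_insert_if)
  ultimately show "card (cycles p S) = Suc (card (cycles q S))" by simp
qed

lemma card_cycles_transpose_split:
  assumes p: "p permutes S" and S: "finite S" and a: "a \<in> S" and b: "b \<in> orbit p a" "b \<noteq> a"
  shows "card (cycles (Transposition.transpose a b \<circ> p) S) = Suc (card (cycles p S))"
proof -
  have pp: "permutation p" using S p by (rule permutes_imp_permutation)
  obtain k where k: "0 < k" "k < card (orbit p a)" "b = (p ^^ k) a"
    using orbit_power_index[OF pp b] by metis
  note s = cycles_transpose_split[OF p S a k]
  have "orbit p a \<in> cycles p S" using a by (auto simp: cycles_def)
  then have "card (cycles p S) = Suc (card (cycles p S - {orbit p a}))"
    using S by (intro card.remove) auto
  moreover have "card (cycles (Transposition.transpose a b \<circ> p) S) = Suc (Suc (card (cycles p S - {orbit p a})))"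
    unfolding s(1) using s(2-) S by (auto simp: card_insert_if)
  ultimately show ?thesis by simp
qed

section \<open>Deleting a point, and multiplicative weights on cycles\<close>

text \<open>Bypasses \<open>z\<close>: the predecessor of \<open>z\<close> is sent to
  \<open>p z\<close>, and \<open>z\<close> becomes fixed. Written with a transposition, this is the
  splitting above with \<open>k = 1\<close>.\<close>

definition del :: "'a \<Rightarrow> ('a \<Rightarrow> 'a) \<Rightarrow> 'a \<Rightarrow> 'a" where
  "del z p = Transposition.transpose z (p z) \<circ> p"

lemma del_fixes [simp]: "del z p z = z"
  by (simp add: del_def)

lemma del_permutes:
  assumes "p permutes S" "z \<in> S"
  shows "del z p permutes S" "del z p permutes (S - {z})"
proof -
  show *: "del z p permutes S" unfolding del_def
    using assms by (intro permutes_compose permutes_swap_id) (auto simp: permutes_in_image)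
  show "del z p permutes (S - {z})"
    by (rule permutes_superset[OF *]) auto
qed

lemma cycles_remove_fixpoint:
  assumes p: "p permutes S" and S: "finite S" and z: "z \<in> S" "p z = z"
  shows "cycles p S = insert {z} (cycles p (S - {z}))" "{z} \<notin> cycles p (S - {z})"
proof -
  have oz: "orbit p z = {z}" using z by (simp add: orbit_eq_singleton_iff)
  have "insert z (S - {z}) = S" using z by auto
  then show "cycles p S = insert {z} (cycles p (S - {z}))"
    unfolding cycles_def using oz by (metis image_insert)
  show "{z} \<notin> cycles p (S - {z})"
    using permutation_self_in_orbit[OF permutation_if_permutes_finite[OF p S]] by (fastforce simp: cycles_def)
qed

text \<open>If \<open>z\<close> is moved, splitting off \<open>{z}\<close> creates a cycle and
  restricting to \<open>S - {z}\<close> drops it again. If \<open>z\<close> is fixed, its own cycle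
  is lost.\<close>

lemma cycles_del:
  assumes p: "p permutes S" and S: "finite S" and z: "z \<in> S"
  shows "card (cycles p S) = card (cycles (del z p) (S - {z})) + (if p z = z then 1 else 0)"
proof -
  note r = cycles_remove_fixpoint[OF del_permutes(1)[OF p z] S z del_fixes]
  have 1: "card (cycles (del z p) S) = Suc (card (cycles (del z p) (S - {z})))"
    using r S by (simp add: card_insert_if)
  show ?thesis
  proof (cases "p z = z")
    case True
    then have "del z p = p" by (auto simp: del_def)
    then show ?thesis using 1 True by simp
  next
    case False
    have "card (cycles (del z p) S) = Suc (card (cycles p S))"
      unfolding del_def using False
      by (intro card_cycles_transpose_split[OF p S z]) (auto intro: orbit.base)
    then show ?thesis using 1 False by simp
  qed
qed

text \<open>With \<open>w = cycle_poly\<close> this is the product over cycle lengths in the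
  integrand.\<close>

definition cycle_prod :: "(nat \<Rightarrow> 'b) \<Rightarrow> ('a \<Rightarrow> 'a) \<Rightarrow> 'a set \<Rightarrow> 'b::comm_monoid_mult" where
  "cycle_prod w p S = (\<Prod>c\<in>cycles p S. w (card c))"

lemma cycle_prod_del:
  assumes p: "p permutes S" and S: "finite S" and z: "z \<in> S" and w: "w 1 = 1"
  shows "cycle_prod w (del z p) (S - {z}) =
    (if p z = z then 1 else w (card (orbit p z) - 1)) * (\<Prod>c\<in>cycles p S - {orbit p z}. w (card c))"
proof -
  note r = cycles_remove_fixpoint[OF del_permutes(1)[OF p z] S z del_fixes]
  have oz: "orbit (del z p) z = {z}" by (simp add: orbit_eq_singleton_iff)
  show ?thesis
  proof (cases "p z = z")
    case True
    then have "del z p = p" by (auto simp: del_def)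
    moreover have "cycles p S - {{z}} = cycles p (S - {z})" using r calculation by auto
    ultimately show ?thesis using True oz by (simp add: cycle_prod_def)
  next
    case False
    let ?l = "card (orbit p z)"
    have pp: "permutation p" using S p by (rule permutes_imp_permutation)
    have "card (orbit p z) \<noteq> 0" "card (orbit p z) \<noteq> 1"
      using orbit_enum(2)[OF pp, of z] permutation_self_in_orbit[OF pp, of z] orbit.base[of p z] False
      by (auto simp: card_eq_0_iff card_1_singleton_iff finite_orbit)
    then have k: "0 < (1::nat)" "1 < card (orbit p z)" "p z = (p ^^ 1) z" by auto
    note s = cycles_transpose_split[OF p S z k, folded del_def]
    note d = transpose_split_disjoint[OF pp k, folded del_def]
    have "cycles (del z p) (S - {z}) = insert (orbit (del z p) (p z)) (cycles p S - {orbit p z})"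
    proof -
      have "cycles (del z p) (S - {z}) = cycles (del z p) S - {{z}}" using r by simp
      also have "\<dots> = insert (orbit (del z p) (p z)) (cycles p S - {orbit p z})"
        using s(2,3) unfolding s(1) oz by auto
      finally show ?thesis .
    qed
    then show ?thesis using False d(4) s(4) S by (simp add: cycle_prod_def)
  qed
qed

text \<open>The cycle of \<open>z\<close> splits into a piece of length \<open>k\<close> through
  \<open>z\<close> and a piece of the remaining length. Deleting \<open>z\<close> shortens the first
  piece to \<open>k - 1\<close>, or removes it when \<open>k = 1\<close>.\<close>

lemma cycle_prod_del_transpose_same:
  assumes p: "p permutes S" and S: "finite S" and z: "z \<in> S" and w: "w 1 = 1"
    and k: "0 < k" "k < card (orbit p z)"
  shows "cycle_prod w (del z (Transposition.transpose z ((p ^^ k) z) \<circ> p)) (S - {z}) =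
    (if k = 1 then 1 else w (k - 1)) * w (card (orbit p z) - k) *
    (\<Prod>c\<in>cycles p S - {orbit p z}. w (card c))"
proof -
  have pp: "permutation p" using S p by (rule permutes_imp_permutation)
  define j where j: "j = (p ^^ k) z"
  have jS: "j \<in> S" using z permutes_in_funpow_image[OF p z] j by simp
  define q where "q = Transposition.transpose z j \<circ> p"
  have q: "q permutes S" unfolding q_def using z jS p by (intro permutes_compose permutes_swap_id)
  note s = cycles_transpose_split[OF p S z k j, folded q_def]
  note d = transpose_split_disjoint[OF pp k j, folded q_def]
  have "cycles q S - {orbit q z} = insert (orbit q j) (cycles p S - {orbit p z})"
    using s by auto
  moreover have "q z = z \<longleftrightarrow> k = 1"
  proof
    assume "q z = z"
    then have "orbit q z = {z}" by (simp add: orbit_eq_singleton_iff)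
    then show "k = 1" using d(3) by simp
  qed (simp add: j q_def)
  ultimately show ?thesis
    unfolding j[symmetric] q_def[symmetric] cycle_prod_del[where w = w, OF q S z w]
    using d(3,4) s(4) S by (simp add: mult.assoc)
qed

text \<open>The cycles of \<open>z\<close> and \<open>j\<close> merge, and deleting \<open>z\<close>
  shortens the merged cycle by one.\<close>

lemma cycle_prod_del_transpose_other:
  assumes p: "p permutes S" and S: "finite S" and z: "z \<in> S" and w: "w 1 = 1"
    and j: "j \<in> S" "j \<notin> orbit p z"
  shows "cycle_prod w (del z (Transposition.transpose z j \<circ> p)) (S - {z}) =
    w (card (orbit p z) + card (orbit p j) - 1) *
    (\<Prod>c\<in>cycles p S - {orbit p z} - {orbit p j}. w (card c))"
proof -
  have pp: "permutation p" using S p by (rule permutes_imp_permutation)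
  define q where "q = Transposition.transpose z j \<circ> p"
  have q: "q permutes S" unfolding q_def using z j p by (intro permutes_compose permutes_swap_id)
  note m = cycles_transpose_merge[OF p S z j, folded q_def]
  have "q z \<noteq> z"
  proof
    assume "q z = z"
    then have "orbit q z = {z}" by (simp add: orbit_eq_singleton_iff)
    then have "orbit p j \<subseteq> {z}" "orbit p z \<subseteq> {z}" using m(2) by auto
    then show False using m(4) orbit_nonempty by (metis subset_singletonD)
  qed
  moreover have "cycles p S - {orbit p z, orbit p j} = cycles p S - {orbit p z} - {orbit p j}" by auto
  ultimately show ?thesis
    unfolding q_def[symmetric] cycle_prod_del[where w = w, OF q S z w] using m(1,3) by simp
qed

section \<open>The polynomial of a cycle length\<close>

text \<open>The number \<open>\<integral>\<^sub>0\<^sup>1 (p x - p 0) / x dx\<close>.\<close>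

definition shifted_integral :: "real poly \<Rightarrow> real" where
  "shifted_integral p = (\<Sum>i=1..Polynomial.degree p. coeff p i / i)"

lemma shifted_integral_eq:
  assumes "Polynomial.degree p \<le> n"
  shows "shifted_integral p = (\<Sum>i=1..n. coeff p i / i)"
  unfolding shifted_integral_def using assms
  by (intro sum.mono_neutral_left) (auto simp: coeff_eq_0)

lemma shifted_integral_0 [simp]: "shifted_integral 0 = 0"
  by (simp add: shifted_integral_def)

lemma shifted_integral_add: "shifted_integral (p + q) = shifted_integral p + shifted_integral q"
proof -
  let ?n = "max (Polynomial.degree p) (Polynomial.degree q)"
  have "Polynomial.degree (p + q) \<le> ?n" by (rule degree_add_le) auto
  then show ?thesis
    by (simp add: shifted_integral_eq[of _ ?n] add_divide_distrib sum.distrib)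
qed

lemma shifted_integral_smult: "shifted_integral (smult c p) = c * shifted_integral p"
  by (simp add: shifted_integral_eq[of _ "Polynomial.degree p"] sum_distrib_left)

lemma shifted_integral_minus: "shifted_integral (- p) = - shifted_integral p"
  using shifted_integral_smult[of "-1" p] by simp

lemma shifted_integral_diff: "shifted_integral (p - q) = shifted_integral p - shifted_integral q"
  using shifted_integral_add[of p "- q"] by (simp add: shifted_integral_minus)

lemma shifted_integral_of_nat_mult: "shifted_integral (of_nat m * p) = m * shifted_integral p"
  using shifted_integral_smult[of "of_nat m" p] by (simp add: of_nat_poly)

lemma shifted_integral_numeral_mult:
  "shifted_integral (numeral m * p) = numeral m * shifted_integral p"
  using shifted_integral_of_nat_mult[of "numeral m" p] by simp

lemma shifted_integral_sum: "shifted_integral (sum f I) = (\<Sum>i\<in>I. shifted_integral (f i))"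
  by (induction I rule: infinite_finite_induct) (auto simp: shifted_integral_add)

text \<open>The fundamental theorem of calculus on [0, 1]: the factor x cancels the division by x.
  All integrals below are evaluated through this.\<close>

lemma shifted_integral_pderiv: "shifted_integral (pCons 0 (pderiv q)) = poly q 1 - poly q 0"
proof -
  let ?n = "Polynomial.degree q"
  have "Polynomial.degree (pCons 0 (pderiv q)) \<le> ?n"
    using degree_pCons_le[of 0 "pderiv q"]
    by (cases "pderiv q = 0") (auto simp: degree_pderiv pderiv_eq_0_iff)
  then have "shifted_integral (pCons 0 (pderiv q)) = (\<Sum>i=1..?n. coeff q i)"
    by (auto simp: shifted_integral_eq coeff_pCons coeff_pderiv intro!: sum.cong split: nat.split)
  also have "\<dots> = (\<Sum>i\<le>?n. coeff q i) - coeff q 0"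
    by (simp add: atMost_atLeast0 sum.atLeast_Suc_atMost)
  finally show ?thesis by (simp add: poly_altdef poly_0_coeff_0)
qed

section \<open>Identities for the polynomials of cycle lengths\<close>

definition pA :: "real poly" where "pA = [:1, -1:]"
definition pB :: "real poly" where "pB = [:0, -1:]"

text \<open>Since \<open>pA - pB = 1\<close>, this is the Lucas sequence U_k with roots
  \<open>pA\<close> and \<open>pB\<close>, that is \<open>(pA ^ k - pB ^ k)\<close> divided by
  \<open>pA - pB\<close>.\<close>

definition cycle_poly :: "nat \<Rightarrow> real poly" where
  "cycle_poly k = pA ^ k - pB ^ k"

lemma pA_eq: "pA = pB + 1"
  by (simp add: pA_def pB_def one_pCons)

lemma pderiv_pA [simp]: "pderiv pA = - 1" and pderiv_pB [simp]: "pderiv pB = - 1"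
  by (simp_all add: pA_def pB_def one_pCons pderiv_pCons)

lemma cycle_poly_0 [simp]: "cycle_poly 0 = 0"
  by (simp add: cycle_poly_def)

lemma cycle_poly_1: "cycle_poly 1 = 1"
  by (simp add: cycle_poly_def pA_eq)

lemma poly_cycle_poly_0: "k > 0 \<Longrightarrow> poly (cycle_poly k) 0 = 1"
  by (simp add: cycle_poly_def pA_def pB_def)

lemma shifted_integral_pB_pderiv: "shifted_integral (pB * pderiv q) = poly q 0 - poly q 1"
  using shifted_integral_pderiv[of "- q"] by (simp add: pB_def pderiv_minus)

lemma pderiv_cycle_poly: "pderiv (cycle_poly (Suc k)) = - (of_nat (Suc k) * cycle_poly k)"
  unfolding cycle_poly_def pderiv_diff pderiv_power_Suc
  by (simp add: of_nat_poly algebra_simps)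

text \<open>Expanding each product gives \<open>m + 1\<close> copies of
  \<open>pA ^ m + pB ^ m\<close>, minus two geometric sums. Each of these is
  \<open>cycle_poly (Suc m)\<close>, because the factor \<open>pA - pB\<close> in the factorization
  of a difference of powers is 1.\<close>

lemma cycle_poly_convolution:
  "(\<Sum>i\<le>m. cycle_poly i * cycle_poly (m - i)) =
     of_nat (Suc m) * (pA ^ m + pB ^ m) - 2 * cycle_poly (Suc m)"
proof -
  have "cycle_poly i * cycle_poly (m - i) = pA ^ m + pB ^ m - pB ^ (m - i) * pA ^ i - pA ^ (m - i) * pB ^ i"
    if "i \<le> m" for i
  proof -
    have "pA ^ i * pA ^ (m - i) = pA ^ m" "pB ^ i * pB ^ (m - i) = pB ^ m"
      using that by (simp_all add: power_add[symmetric])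
    then show ?thesis by (simp add: cycle_poly_def algebra_simps)
  qed
  then have "(\<Sum>i\<le>m. cycle_poly i * cycle_poly (m - i)) =
      (\<Sum>i\<le>m. pA ^ m + pB ^ m - pB ^ (m - i) * pA ^ i - pA ^ (m - i) * pB ^ i)"
    by (intro sum.cong) auto
  also have "\<dots> = of_nat (Suc m) * (pA ^ m + pB ^ m)
      - (\<Sum>i<Suc m. pB ^ (Suc m - Suc i) * pA ^ i) - (\<Sum>i<Suc m. pA ^ (Suc m - Suc i) * pB ^ i)"
    by (simp add: sum_subtractf lessThan_Suc_atMost)
  also have "(\<Sum>i<Suc m. pB ^ (Suc m - Suc i) * pA ^ i) = cycle_poly (Suc m)"
    using power_diff_sumr2[of pA "Suc m" pB] by (simp add: cycle_poly_def pA_eq)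
  also have "(\<Sum>i<Suc m. pA ^ (Suc m - Suc i) * pB ^ i) = cycle_poly (Suc m)"
    using power_diff_sumr2[of pB "Suc m" pA] by (simp add: cycle_poly_def pA_eq algebra_simps)
  finally show ?thesis by simp
qed

text \<open>The addition formula of Lucas sequences. It expresses the factor of a merged cycle
  through those of its two parts.\<close>

lemma cycle_poly_add:
  "cycle_poly (Suc (k + m)) =
     cycle_poly (Suc k) * cycle_poly (Suc m) - pA * pB * cycle_poly k * cycle_poly m"
proof -
  have "cycle_poly (Suc k) * cycle_poly (Suc m) - pA * pB * cycle_poly k * cycle_poly m =
      (pA - pB) * cycle_poly (Suc (k + m))"
    by (simp add: cycle_poly_def algebra_simps power_add)
  then show ?thesis by (simp add: pA_eq)
qed

text \<open>The addition formula splits each factor in two. In the second part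
  \<open>of_nat (s c) * cycle_poly (s c - 1)\<close> is minus the derivative of
  \<open>cycle_poly (s c)\<close>, so the sum over \<open>c\<close> is the product rule.\<close>

lemma sum_merge_cycle_poly:
  assumes "finite C" and pos: "\<And>c. c \<in> C \<Longrightarrow> s c > 0"
  shows "(\<Sum>c\<in>C. of_nat (s c) * (cycle_poly (Suc k + s c - 1) * (\<Prod>d\<in>C - {c}. cycle_poly (s d)))) =
    of_nat (\<Sum>c\<in>C. s c) * cycle_poly (Suc k) * (\<Prod>d\<in>C. cycle_poly (s d)) +
    pA * pB * cycle_poly k * pderiv (\<Prod>d\<in>C. cycle_poly (s d))"
proof -
  let ?R = "\<Prod>d\<in>C. cycle_poly (s d)"
  have "of_nat (s c) * (cycle_poly (Suc k + s c - 1) * (\<Prod>d\<in>C - {c}. cycle_poly (s d))) =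
      of_nat (s c) * cycle_poly (Suc k) * ?R +
      pA * pB * cycle_poly k * ((\<Prod>d\<in>C - {c}. cycle_poly (s d)) * pderiv (cycle_poly (s c)))"
    if c: "c \<in> C" for c
  proof -
    obtain m where m: "s c = Suc m" using pos[OF c] by (cases "s c") auto
    have R: "?R = cycle_poly (s c) * (\<Prod>d\<in>C - {c}. cycle_poly (s d))"
      using assms(1) c by (rule prod.remove)
    have e: "cycle_poly (Suc k + s c - 1) =
        cycle_poly (Suc k) * cycle_poly (Suc m) - pA * pB * cycle_poly k * cycle_poly m"
      by (simp add: m cycle_poly_add)
    show ?thesis
      unfolding R e unfolding m pderiv_cycle_poly by (simp add: algebra_simps)
  qed
  then have "(\<Sum>c\<in>C. of_nat (s c) * (cycle_poly (Suc k + s c - 1) * (\<Prod>d\<in>C - {c}. cycle_poly (s d)))) =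
      (\<Sum>c\<in>C. of_nat (s c) * cycle_poly (Suc k) * ?R +
      pA * pB * cycle_poly k * ((\<Prod>d\<in>C - {c}. cycle_poly (s d)) * pderiv (cycle_poly (s c))))"
    by (intro sum.cong) auto
  also have "\<dots> = of_nat (\<Sum>c\<in>C. s c) * cycle_poly (Suc k) * ?R + pA * pB * cycle_poly k * pderiv ?R"
    unfolding sum.distrib pderiv_prod by (simp add: sum_distrib_left sum_distrib_right)
  finally show ?thesis .
qed

text \<open>
  The index \<open>k = 1\<close> is special because deleting \<open>z\<close> then leaves no cycle at all, which must
  contribute the factor 1 and not \<open>cycle_poly 0 = 0\<close>.
\<close>

lemma sum_split_cycle_poly:
  assumes l: "l \<ge> 2"
  shows "(\<Sum>k=1..<l. (if k = 1 then 1 else cycle_poly (k - 1)) * cycle_poly (l - k)) =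
     cycle_poly (l - 1) + of_nat l * (pA ^ (l - 1) + pB ^ (l - 1)) - 2 * cycle_poly l"
proof -
  obtain m where m: "l = Suc (Suc m)" using l by (cases l; cases "l - 1") auto
  have "(\<Sum>k=1..<l. (if k = 1 then 1 else cycle_poly (k - 1)) * cycle_poly (l - k)) =
      (\<Sum>i<Suc m. (if i = 0 then 1 else cycle_poly i) * cycle_poly (Suc m - i))"
    unfolding m by (rule sum.reindex_bij_witness[of _ Suc "\<lambda>k. k - 1"]) auto
  also have "\<dots> = (\<Sum>i<Suc m. (if i = 0 then cycle_poly (Suc m) else 0) + cycle_poly i * cycle_poly (Suc m - i))"
    by (intro sum.cong) auto
  also have "\<dots> = cycle_poly (Suc m) + (\<Sum>i<Suc m. cycle_poly i * cycle_poly (Suc m - i))"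
    by (simp only: sum.distrib) simp
  \<comment> \<open>The added term \<open>i = Suc m\<close> has the factor
    \<open>cycle_poly 0 = 0\<close>.\<close>
  also have "(\<Sum>i<Suc m. cycle_poly i * cycle_poly (Suc m - i)) = (\<Sum>i\<le>Suc m. cycle_poly i * cycle_poly (Suc m - i))"
    by (simp add: lessThan_Suc_atMost)
  finally show ?thesis by (simp only: cycle_poly_convolution) (simp add: m)
qed

text \<open>Here \<open>R\<close> stands for the product over the cycles not containing
  \<open>z\<close>, and \<open>l\<close> for the length of the cycle of \<open>z\<close>. The
  right-hand side is x times a derivative, so its \<open>shifted_integral\<close> reduces to
  boundary values.\<close>

lemma cycle_poly_telescope:
  assumes l: "l \<ge> 2"
  shows "of_nat (l - 1) * (pA * (cycle_poly l * R))
    - pA * ((cycle_poly (l - 1) + of_nat l * (pA ^ (l - 1) + pB ^ (l - 1)) - 2 * cycle_poly l) * R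
       + pA * pB * cycle_poly (l - 1) * pderiv R)
    = - (pB * pderiv (pA ^ 2 * cycle_poly (l - 1) * R))"
proof -
  obtain m where m: "l = Suc (Suc m)" using l by (cases l; cases "l - 1") auto
  have d: "pderiv (pA ^ 2) = - (2 * pA)"
    by (simp add: power2_eq_square pderiv_mult)
  \<comment> \<open>With the powers abstracted and \<open>pA\<close> replaced by
    \<open>pB + 1\<close>, a plain ring identity remains, in which \<open>R\<close> and its
    derivative are independent symbols.\<close>
  define P Q where PQ: "P = pA ^ m" "Q = pB ^ m"
  show ?thesis
    unfolding m diff_Suc_1 pderiv_mult d pderiv_cycle_poly
    unfolding cycle_poly_def power_Suc power2_eq_square of_nat_Suc PQ[symmetric]
    unfolding pA_eq by (simp add: algebra_simps)
qed

section \<open>Integrals for the final evaluation\<close>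

lemma shifted_integral_pB_power: "shifted_integral (pB ^ Suc k) = (-1) ^ Suc k / real (Suc k)"
proof -
  have "of_nat (Suc k) * pB ^ Suc k = - (pB * pderiv (pB ^ Suc k))"
    unfolding pderiv_power_Suc by (simp add: of_nat_poly)
  then have "real (Suc k) * shifted_integral (pB ^ Suc k) = (-1) ^ Suc k"
    by (simp only: shifted_integral_of_nat_mult[symmetric] shifted_integral_minus
        shifted_integral_pB_pderiv) (simp add: pB_def)
  then show ?thesis by (simp add: field_simps del: of_nat_Suc power_Suc)
qed

lemma shifted_integral_pB_pA_power: "shifted_integral (pB * pA ^ k) = - 1 / real (Suc k)"
proof -
  have "of_nat (Suc k) * (pB * pA ^ k) = - (pB * pderiv (pA ^ Suc k))"
    unfolding pderiv_power_Suc by (simp add: of_nat_poly)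
  then have "real (Suc k) * shifted_integral (pB * pA ^ k) = - 1"
    by (simp only: shifted_integral_of_nat_mult[symmetric] shifted_integral_minus
        shifted_integral_pB_pderiv) (simp add: pA_def)
  then show ?thesis by (simp add: field_simps del: of_nat_Suc)
qed

text \<open>Compares one cycle of length \<open>n\<close> with its splittings into \<open>k\<close>
  and \<open>n - k\<close>, summed over the \<open>n - 1\<close> values of \<open>k\<close>. The
  convolution formula turns everything into terms with known integrals.\<close>

lemma shifted_integral_split_cycle:
  assumes n: "n \<ge> 2"
  shows "shifted_integral (pA * (of_nat (n - 1) * cycle_poly n
      - (\<Sum>k=1..<n. cycle_poly k * cycle_poly (n - k)))) = - 2 * (1 + (-1) ^ n) / (real n + 2)"
proof -
  obtain m where m: "n = Suc m" using n by (cases n) auto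
  \<comment> \<open>The end terms \<open>k = 0\<close> and \<open>k = n\<close> vanish because
    \<open>cycle_poly 0 = 0\<close>.\<close>
  have "(\<Sum>k=1..<n. cycle_poly k * cycle_poly (n - k)) = (\<Sum>k\<le>n. cycle_poly k * cycle_poly (n - k))"
    by (rule sum.mono_neutral_left) (auto simp: not_less le_less)
  also have "\<dots> = of_nat (Suc n) * (pA ^ n + pB ^ n) - 2 * cycle_poly (Suc n)"
    by (rule cycle_poly_convolution)
  finally have "pA * (of_nat (n - 1) * cycle_poly n - (\<Sum>k=1..<n. cycle_poly k * cycle_poly (n - k)))
    = pA * (of_nat (n - 1) * cycle_poly n - (of_nat (Suc n) * (pA ^ n + pB ^ n) - 2 * cycle_poly (Suc n)))"
    by simp
  \<comment> \<open>The pure powers of \<open>pA\<close> combine to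
    \<open>2 * pA ^ Suc n * (pA - 1)\<close>, and \<open>pA - 1 = pB\<close>.\<close>
  also have "\<dots> = 2 * (pB * pA ^ Suc n) - of_nat (2 * n) * pB ^ n
      - of_nat (2 * Suc n) * pB ^ Suc n - 2 * pB ^ Suc (Suc n)"
  proof -
    define P Q where PQ: "P = pA ^ m" "Q = pB ^ m"
    show ?thesis
      unfolding m cycle_poly_def diff_Suc_1 power_Suc of_nat_Suc of_nat_mult PQ[symmetric]
      unfolding pA_eq by (simp add: algebra_simps)
  qed
  finally have eq: "pA * (of_nat (n - 1) * cycle_poly n - (\<Sum>k=1..<n. cycle_poly k * cycle_poly (n - k)))
    = 2 * (pB * pA ^ Suc n) - of_nat (2 * n) * pB ^ n
      - of_nat (2 * Suc n) * pB ^ Suc n - 2 * pB ^ Suc (Suc n)" .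
  \<comment> \<open>The coefficients of \<open>pB ^ n\<close> and \<open>pB ^ Suc n\<close> cancel
    the denominators of their integrals. The two contributions then have opposite signs, and only
    the terms with denominator \<open>n + 2\<close> survive.\<close>
  have cancel: "real (2 * Suc k) * (c / real (Suc k)) = 2 * c" for k c
    by (simp add: field_simps)
  show ?thesis
    unfolding eq shifted_integral_diff shifted_integral_of_nat_mult shifted_integral_numeral_mult
      shifted_integral_pB_pA_power
    unfolding m shifted_integral_pB_power cancel
    by (simp add: add_divide_distrib diff_divide_distrib add.commute)
qed

section \<open>Full cycles\<close>

text \<open>Used to turn sums over the other points of a cycle into sums over the exponent
  \<open>k\<close>.\<close>

lemma orbit_power_bij:
  assumes "permutation p"
  shows "bij_betw (\<lambda>k. (p ^^ k) a) {1..<card (orbit p a)} (orbit p a - {a})"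
proof -
  let ?f = "\<lambda>k. (p ^^ k) a" and ?l = "card (orbit p a)"
  note inj = orbit_enum(1)[OF assms, of a]
  have "0 < ?l"
    using permutation_self_in_orbit[OF assms, of a] by (auto simp: card_gt_0_iff finite_orbit)
  moreover have "bij_betw ?f {..<?l} (orbit p a)"
    using inj orbit_enum(2)[OF assms, of a] by (auto simp: bij_betw_def)
  ultimately have "bij_betw ?f ({..<?l} - {0}) (orbit p a - {?f 0})"
    using permutation_self_in_orbit[OF assms, of a]
    by (intro bij_betw_DiffI) (auto simp: bij_betw_def)
  moreover have "{..<?l} - {0} = {1..<?l}" by auto
  ultimately show ?thesis by simp
qed

lemma card_cycle_pos:
  assumes "p permutes S" "finite S" "c \<in> cycles p S"
  shows "0 < card c"
proof -
  have "finite (orbit p x)" for x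
    using permutation_self_in_orbit[OF permutation_if_permutes_finite[OF assms(1,2)]] by (rule finite_orbit)
  then show ?thesis using assms(3) by (auto simp: cycles_def card_gt_0_iff orbit_nonempty)
qed

section \<open>Invariance under conjugation\<close>

lemma comp_transpose: "bij u \<Longrightarrow> u \<circ> Transposition.transpose a b = Transposition.transpose (u a) (u b) \<circ> u"
  by (auto simp: fun_eq_iff Transposition.transpose_def bij_def inj_def)

lemma cycles_semiconj:
  assumes p: "p permutes S" and S: "finite S" and h: "h permutes S" and eq: "h \<circ> p = q \<circ> h"
  shows "cycles q S = (`) h ` cycles p S"
proof -
  have "h ` orbit p x = orbit q (h x)" for x
    using fun_cong[OF eq] permutation_self_in_orbit[OF permutation_if_permutes_finite[OF p S]]
    by (intro orbit_inverse) auto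
  then have "(`) h ` cycles p S = (\<lambda>x. orbit q (h x)) ` S"
    by (simp add: cycles_def image_image)
  also have "\<dots> = orbit q ` (h ` S)" by (simp add: image_image)
  finally show ?thesis using permutes_image[OF h] by (simp add: cycles_def)
qed

lemma inj_on_image_permutes: "h permutes S \<Longrightarrow> inj_on ((`) h) A"
  by (meson inj_image_eq_iff inj_onI permutes_inj)

text \<open>The two products are conjugate by \<open>g\<close>.\<close>

lemma card_cycles_comp_commute:
  assumes "f permutes S" "g permutes S" "finite S"
  shows "card (cycles (f \<circ> g) S) = card (cycles (g \<circ> f) S)"
proof -
  have "cycles (g \<circ> f) S = (`) g ` cycles (f \<circ> g) S"
    using assms by (intro cycles_semiconj permutes_compose) (auto simp: comp_assoc)
  then show ?thesis by (simp add: card_image inj_on_image_permutes[OF assms(2)])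
qed

lemma cycle_prod_semiconj:
  assumes p: "p permutes S" and S: "finite S" and h: "h permutes S" and eq: "h \<circ> p = q \<circ> h"
  shows "cycle_prod w q S = cycle_prod w p S"
  unfolding cycle_prod_def cycles_semiconj[OF assms]
  by (simp add: prod.reindex[OF inj_on_image_permutes[OF h]] card_image[OF permutes_inj_on[OF h]])

section \<open>Full cycles and the removal of a point\<close>

text \<open>Generalizes \<open>n_cycles\<close> to arbitrary sets, so that an induction can remove
  any point.\<close>

definition full_cycles :: "'a set \<Rightarrow> ('a \<Rightarrow> 'a) set" where
  "full_cycles S = {u. u permutes S \<and> cyclic_on u S}"

lemma finite_full_cycles [simp]: "finite S \<Longrightarrow> finite (full_cycles S)"
  unfolding full_cycles_def by (rule finite_subset[OF _ finite_permutations[of S]]) auto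

lemma orbit_full_cycle: "u \<in> full_cycles S \<Longrightarrow> x \<in> S \<Longrightarrow> orbit u x = S"
  by (simp add: full_cycles_def orbit_cyclic_eq3)

lemma full_cycles_permutes: "u \<in> full_cycles S \<Longrightarrow> u permutes S"
  by (simp add: full_cycles_def)

lemma cycles_full_cycle:
  assumes "u \<in> full_cycles S"
  shows "cycles u S = {S}"
proof -
  have "S \<noteq> {}" using assms by (auto simp: full_cycles_def cyclic_on_def)
  moreover have "cycles u S = (\<lambda>_. S) ` S"
    unfolding cycles_def using orbit_full_cycle[OF assms] by (intro image_cong) auto
  ultimately show ?thesis by auto
qed

lemma del_full_cycle:
  assumes u: "u \<in> full_cycles S" and S: "finite S" "z \<in> S" "S \<noteq> {z}"
  shows "u z \<in> S - {z}" "del z u \<in> full_cycles (S - {z})"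
proof -
  have p: "u permutes S" using u by (rule full_cycles_permutes)
  have pp: "permutation u" using S(1) p by (rule permutes_imp_permutation)
  have o: "orbit u z = S" using u S(2) by (rule orbit_full_cycle)
  have "u z \<noteq> z" using o S(3) by (metis orbit_eq_singleton_iff)
  then show uz: "u z \<in> S - {z}" using p S(2) by (simp add: permutes_in_image)
  have "card S \<noteq> 0" using S by auto
  moreover have "card S \<noteq> 1" using S by (auto simp: card_1_singleton_iff)
  ultimately have k: "0 < (1::nat)" "1 < card (orbit u z)" "u z = (u ^^ 1) z" unfolding o by auto
  note d = transpose_split_disjoint[OF pp k, folded del_def]
  have "orbit (del z u) z = {z}" by (simp add: orbit_eq_singleton_iff)
  then have "orbit (del z u) (u z) = S - {z}" using d(1,2) o by auto
  then have "cyclic_on (del z u) (S - {z})" using uz by (intro cyclic_on_singleI) auto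
  then show "del z u \<in> full_cycles (S - {z})"
    using del_permutes(2)[OF p S(2)] by (simp add: full_cycles_def)
qed

text \<open>The fixed point \<open>z\<close> is merged with the single cycle on the other points.
  This inverts \<open>del\<close>, with \<open>b\<close> recovered as the image of
  \<open>z\<close>.\<close>

lemma insert_full_cycle:
  assumes u: "u \<in> full_cycles (S - {z})" and S: "finite S" "z \<in> S" and b: "b \<in> S - {z}"
  shows "Transposition.transpose z b \<circ> u \<in> full_cycles S" "u z = z"
proof -
  have pz: "u permutes (S - {z})" using u by (rule full_cycles_permutes)
  then show z: "u z = z" by (simp add: permutes_not_in)
  have p: "u permutes S" using pz by (rule permutes_subset) auto
  have oz: "orbit u z = {z}" using z by (simp add: orbit_eq_singleton_iff)
  have ob: "orbit u b = S - {z}" using u b by (rule orbit_full_cycle)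
  have "b \<in> S" "b \<notin> orbit u z" using b oz by auto
  note m = cycles_transpose_merge(2)[OF p S this]
  have "orbit (Transposition.transpose z b \<circ> u) z = S" unfolding m oz ob using S by auto
  then have "cyclic_on (Transposition.transpose z b \<circ> u) S"
    using S(2) by (intro cyclic_on_singleI) auto
  moreover have "Transposition.transpose z b \<circ> u permutes S"
    using p S b by (intro permutes_compose permutes_swap_id) auto
  ultimately show "Transposition.transpose z b \<circ> u \<in> full_cycles S" by (simp add: full_cycles_def)
qed

text \<open>Deletion and insertion give a bijection between full cycles of \<open>S\<close> and
  pairs of a full cycle \<open>u\<close> of \<open>S - {z}\<close> and a point \<open>b\<close>.
  Replacing \<open>b\<close> by \<open>u j\<close> moves the transposition to the right of
  \<open>u\<close>, where it can be absorbed into a permutation that \<open>u\<close>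
  multiplies.\<close>

lemma sum_full_cycles_remove:
  assumes S: "finite S" "z \<in> S" "S \<noteq> {z}"
  shows "(\<Sum>u\<in>full_cycles S. f u) =
    (\<Sum>u\<in>full_cycles (S - {z}). \<Sum>j\<in>S - {z}. f (u \<circ> Transposition.transpose z j))"
proof -
  have "(\<Sum>j\<in>S - {z}. f (u \<circ> Transposition.transpose z j)) =
      (\<Sum>b\<in>S - {z}. f (Transposition.transpose z b \<circ> u))" if u: "u \<in> full_cycles (S - {z})" for u
  proof -
    have p: "u permutes (S - {z})" using u by (rule full_cycles_permutes)
    then have "u z = z" by (simp add: permutes_not_in)
    then have "u \<circ> Transposition.transpose z j = Transposition.transpose z (u j) \<circ> u" for j
      using comp_transpose[OF permutes_bij[OF p], of z j] by simp
    then show ?thesis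
      using sum.reindex_bij_betw[OF permutes_imp_bij[OF p], of "\<lambda>b. f (Transposition.transpose z b \<circ> u)"]
      by simp
  qed
  then have "(\<Sum>u\<in>full_cycles (S - {z}). \<Sum>j\<in>S - {z}. f (u \<circ> Transposition.transpose z j)) =
      (\<Sum>(u, b)\<in>full_cycles (S - {z}) \<times> (S - {z}). f (Transposition.transpose z b \<circ> u))"
    by (simp add: sum.cartesian_product[symmetric])
  also have "\<dots> = (\<Sum>u\<in>full_cycles S. f u)"
  proof (rule sum.reindex_bij_witness[of _ "\<lambda>u. (del z u, u z)" "\<lambda>(u, b). Transposition.transpose z b \<circ> u"])
    fix x assume "x \<in> full_cycles (S - {z}) \<times> (S - {z})"
    then obtain u b where x: "x = (u, b)" "u \<in> full_cycles (S - {z})" "b \<in> S - {z}" by auto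
    note i = insert_full_cycle[OF x(2) S(1,2) x(3)]
    show "(case x of (u, b) \<Rightarrow> Transposition.transpose z b \<circ> u) \<in> full_cycles S"
      using i x by simp
    show "(del z (case x of (u, b) \<Rightarrow> Transposition.transpose z b \<circ> u),
        (case x of (u, b) \<Rightarrow> Transposition.transpose z b \<circ> u) z) = x"
      using i(2) x(1) by (simp add: del_def comp_assoc[symmetric])
  qed (use del_full_cycle[OF _ S] in \<open>auto simp: del_def comp_assoc[symmetric]\<close>)
  finally show ?thesis by simp
qed

lemma card_full_cycles_remove:
  assumes S: "finite S" "z \<in> S" "S \<noteq> {z}"
  shows "card (full_cycles S) = card (full_cycles (S - {z})) * (card S - 1)"
  using sum_full_cycles_remove[OF S, of "\<lambda>_. 1::nat"] S by simp

text \<open>Since \<open>u\<close> fixes \<open>z\<close>, deletion commutes with left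
  multiplication by \<open>u\<close>; and \<open>u o p\<close> fixes \<open>z\<close> exactly when
  \<open>p\<close> does.\<close>

lemma full_cycles_card_cycles_comp_del:
  assumes S: "finite S" "z \<in> S" and u: "u permutes (S - {z})" and p: "p permutes S"
  shows "card (cycles (u \<circ> p) S) = card (cycles (u \<circ> del z p) (S - {z})) + (if p z = z then 1 else 0)"
proof -
  have z: "u z = z" using u by (simp add: permutes_not_in)
  have bij: "bij u" using u by (rule permutes_bij)
  have "u permutes S" using u by (rule permutes_subset) auto
  then have up: "u \<circ> p permutes S" using p by (intro permutes_compose)
  have "del z (u \<circ> p) = u \<circ> del z p"
    using comp_transpose[OF bij, of z "p z"] z by (simp add: del_def comp_assoc[symmetric])
  moreover have "u (p z) = z \<longleftrightarrow> p z = z" using z bij by (metis bij_pointE)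
  ultimately show ?thesis using cycles_del[OF up S] by simp
qed

lemma sum_over_cycles:
  fixes g :: "'a set \<Rightarrow> 'b::comm_semiring_1"
  assumes p: "p permutes S" and S: "finite S"
  shows "(\<Sum>x\<in>S - orbit p z. g (orbit p x)) = (\<Sum>c\<in>cycles p S - {orbit p z}. of_nat (card c) * g c)"
proof -
  note m = mem_cycles_iff[OF p S]
  note self = permutation_self_in_orbit[OF permutation_if_permutes_finite[OF p S]]
  have im: "orbit p ` (S - orbit p z) = cycles p S - {orbit p z}"
    using self orbit_eq_if_mem[OF permutation_if_permutes_finite[OF p S]] by (auto simp: cycles_def)
  have "(\<Sum>x\<in>S - orbit p z. g (orbit p x)) =
      (\<Sum>c\<in>orbit p ` (S - orbit p z). \<Sum>x\<in>{x \<in> S - orbit p z. orbit p x = c}. g (orbit p x))"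
    using S by (intro sum.image_gen) auto
  also have "\<dots> = (\<Sum>c\<in>orbit p ` (S - orbit p z). of_nat (card c) * g c)"
  proof (rule sum.cong[OF refl])
    fix c assume "c \<in> orbit p ` (S - orbit p z)"
    then have c: "c \<in> cycles p S" "c \<noteq> orbit p z" unfolding im by auto
    have "{x \<in> S - orbit p z. orbit p x = c} = c"
    proof (intro set_eqI iffI)
      fix x assume "x \<in> {x \<in> S - orbit p z. orbit p x = c}"
      then show "x \<in> c" using self by auto
    next
      fix x assume "x \<in> c"
      with c m have "x \<in> S" "c = orbit p x" by auto
      with c show "x \<in> {x \<in> S - orbit p z. orbit p x = c}"
        using orbit_eq_if_mem[OF permutation_if_permutes_finite[OF p S]] by auto
    qed
    moreover have "(\<Sum>x\<in>{x \<in> S - orbit p z. orbit p x = c}. g (orbit p x)) =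
        (\<Sum>x\<in>{x \<in> S - orbit p z. orbit p x = c}. g c)"
      by (rule sum.cong) auto
    ultimately show "(\<Sum>x\<in>{x \<in> S - orbit p z. orbit p x = c}. g (orbit p x)) = of_nat (card c) * g c"
      by simp
  qed
  finally show ?thesis by (simp add: im)
qed

section \<open>Expected number of cycles of a product with a full cycle\<close>

text \<open>Points \<open>j\<close> in the cycle of \<open>z\<close> split it and give the first
  summand. Points outside merge two cycles and, grouped by cycle, give the other two;
  \<open>card S - l\<close> is the total length of the other cycles.\<close>

lemma sum_cycle_prod_del_transpose:
  assumes p: "p permutes S" and S: "finite S" and z: "z \<in> S" "p z \<noteq> z"
  defines "l \<equiv> card (orbit p z)"
    and "R \<equiv> \<Prod>c\<in>cycles p S - {orbit p z}. cycle_poly (card c)"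
  shows "(\<Sum>j\<in>S - {z}. cycle_prod cycle_poly (del z (Transposition.transpose z j \<circ> p)) (S - {z})) =
    (cycle_poly (l - 1) + of_nat l * (pA ^ (l - 1) + pB ^ (l - 1)) - 2 * cycle_poly l) * R +
    of_nat (card S - l) * cycle_poly l * R + pA * pB * cycle_poly (l - 1) * pderiv R"
    and "2 \<le> l" "l \<le> card S"
proof -
  define F where "F j = cycle_prod cycle_poly (del z (Transposition.transpose z j \<circ> p)) (S - {z})" for j
  have pp: "permutation p" using S p by (rule permutes_imp_permutation)
  have zo: "z \<in> orbit p z" using pp by (rule permutation_self_in_orbit)
  have oS: "orbit p z \<subseteq> S" using p z(1) by (rule permutes_orbit_subset)
  then show "l \<le> card S" unfolding l_def using S by (intro card_mono)
  have "card {z, p z} \<le> l" unfolding l_def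
    using zo orbit.base[of p z] finite_orbit[OF zo] by (intro card_mono) auto
  then show l2: "2 \<le> l" using z(2) by simp
  have "(\<Sum>j\<in>orbit p z - {z}. F j) = (\<Sum>k=1..<l. F ((p ^^ k) z))"
    unfolding l_def by (rule sum.reindex_bij_betw[OF orbit_power_bij[OF pp], symmetric])
  also have "\<dots> = (\<Sum>k=1..<l. (if k = 1 then 1 else cycle_poly (k - 1)) * cycle_poly (l - k) * R)"
    unfolding F_def R_def l_def
    by (intro sum.cong refl cycle_prod_del_transpose_same p S z cycle_poly_1) auto
  also have "\<dots> = (cycle_poly (l - 1) + of_nat l * (pA ^ (l - 1) + pB ^ (l - 1)) - 2 * cycle_poly l) * R"
    unfolding sum_distrib_right[symmetric] sum_split_cycle_poly[OF l2] ..
  finally have 1: "(\<Sum>j\<in>orbit p z - {z}. F j) = \<dots>" .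

  let ?C = "cycles p S - {orbit p z}"
  define G where "G c = cycle_poly (l + card c - 1) * (\<Prod>d\<in>?C - {c}. cycle_poly (card d))" for c
  have "(\<Sum>j\<in>S - orbit p z. F j) = (\<Sum>j\<in>S - orbit p z. G (orbit p j))"
    unfolding F_def G_def l_def
    by (intro sum.cong refl cycle_prod_del_transpose_other p S z cycle_poly_1) auto
  also have "\<dots> = (\<Sum>c\<in>?C. of_nat (card c) * G c)"
    using p S by (rule sum_over_cycles)
  also have "\<dots> = of_nat (\<Sum>c\<in>?C. card c) * cycle_poly l * R + pA * pB * cycle_poly (l - 1) * pderiv R"
  proof -
    have "0 < card c" if "c \<in> ?C" for c
      using that card_cycle_pos[OF p S] by auto
    then show ?thesis
      using sum_merge_cycle_poly[of ?C card "l - 1"] S l2 unfolding G_def R_def by simp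
  qed
  also have "(\<Sum>c\<in>?C. card c) = card S - l"
  proof -
    have "orbit p z \<in> cycles p S" using z by (simp add: cycles_def)
    then have "(\<Sum>c\<in>cycles p S. card c) = l + (\<Sum>c\<in>?C. card c)"
      unfolding l_def using S by (intro sum.remove) auto
    then show ?thesis using sum_card_cycles[OF p S] by simp
  qed
  finally have 2: "(\<Sum>j\<in>S - orbit p z. F j) = of_nat (card S - l) * cycle_poly l * R +
      pA * pB * cycle_poly (l - 1) * pderiv R" .
  have "S - {z} = (orbit p z - {z}) \<union> (S - orbit p z)" using oS zo by auto
  then have 3: "(\<Sum>j\<in>S - {z}. F j) = (\<Sum>j\<in>orbit p z - {z}. F j) + (\<Sum>j\<in>S - orbit p z. F j)"
    using S finite_orbit[OF zo] by (simp only:) (intro sum.union_disjoint; auto)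
  show "(\<Sum>j\<in>S - {z}. cycle_prod cycle_poly (del z (Transposition.transpose z j \<circ> p)) (S - {z})) =
    (cycle_poly (l - 1) + of_nat l * (pA ^ (l - 1) + pB ^ (l - 1)) - 2 * cycle_poly l) * R +
    of_nat (card S - l) * cycle_poly l * R + pA * pB * cycle_poly (l - 1) * pderiv R"
    unfolding F_def[symmetric] 3 1 2 by (simp only: add.assoc)
qed

text \<open>
  By \<open>cycle_poly_telescope\<close>, the difference of the two sides is the integral of a total
  derivative; the summand 1 is its boundary term at 0.
\<close>

lemma shifted_integral_cycle_prod_rec:
  assumes p: "p permutes S" and S: "finite S" and z: "z \<in> S" "p z \<noteq> z"
  shows "(\<Sum>j\<in>S - {z}. shifted_integral (pA *
      cycle_prod cycle_poly (del z (Transposition.transpose z j \<circ> p)) (S - {z}))) =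
    real (card S - 1) * shifted_integral (pA * cycle_prod cycle_poly p S) + 1"
proof -
  define l R where "l = card (orbit p z)"
    and "R = (\<Prod>c\<in>cycles p S - {orbit p z}. cycle_poly (card c))"
  define X where
    "X = (\<Sum>j\<in>S - {z}. cycle_prod cycle_poly (del z (Transposition.transpose z j \<circ> p)) (S - {z}))"
  note s = sum_cycle_prod_del_transpose[OF p S z, folded l_def R_def, folded X_def]
  have "orbit p z \<in> cycles p S" using z by (simp add: cycles_def)
  then have F: "cycle_prod cycle_poly p S = cycle_poly l * R"
    unfolding cycle_prod_def l_def R_def using S by (intro prod.remove) auto
  \<comment> \<open>The share \<open>card S - l\<close> cancels against the matching summand of
    \<open>X\<close>, which leaves the left-hand side of
    \<open>cycle_poly_telescope\<close>.\<close>
  have "card S - 1 = (l - 1) + (card S - l)" using s(2,3) by simp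
  then have "of_nat (card S - 1) * (pA * (cycle_poly l * R)) - pA * X =
      of_nat (l - 1) * (pA * (cycle_poly l * R))
    - pA * ((cycle_poly (l - 1) + of_nat l * (pA ^ (l - 1) + pB ^ (l - 1)) - 2 * cycle_poly l) * R
       + pA * pB * cycle_poly (l - 1) * pderiv R)"
    unfolding s(1) by (simp only: of_nat_add) (simp add: algebra_simps)
  also have "\<dots> = - (pB * pderiv (pA ^ 2 * cycle_poly (l - 1) * R))"
    using s(2) by (rule cycle_poly_telescope)
  finally have "real (card S - 1) * shifted_integral (pA * (cycle_poly l * R)) - shifted_integral (pA * X) =
      poly (pA ^ 2 * cycle_poly (l - 1) * R) 1 - poly (pA ^ 2 * cycle_poly (l - 1) * R) 0"
    by (simp only: shifted_integral_of_nat_mult[symmetric] shifted_integral_diff[symmetric])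
      (simp only: shifted_integral_minus shifted_integral_pB_pderiv minus_diff_eq)
  \<comment> \<open>At 1 the factor \<open>pA\<close> vanishes. At 0 every factor is 1, where
    \<open>l \<ge> 2\<close> keeps \<open>l - 1\<close> positive.\<close>
  also have "\<dots> = - 1"
  proof -
    have "poly R 0 = 1"
      unfolding R_def poly_prod
      by (intro prod.neutral) (auto intro!: poly_cycle_poly_0 card_cycle_pos[OF p S])
    moreover have "poly (cycle_poly (l - 1)) 0 = 1" using s(2) by (intro poly_cycle_poly_0) auto
    ultimately show ?thesis by (simp add: pA_def)
  qed
  finally show ?thesis
    unfolding F shifted_integral_sum[symmetric] sum_distrib_left[symmetric] X_def[symmetric] by simp
qed

text \<open>The integral formula for the expected number of cycles, multiplied by the number of full
  cycles. The integrand polynomial has value 1 at 0, so the minus sign turns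
  \<open>shifted_integral\<close> into the integral of (1 - P(x)) / x.\<close>

lemma sum_card_cycles_full_cycles_comp:
  assumes "finite S" "S \<noteq> {}" "p permutes S"
  shows "(\<Sum>u\<in>full_cycles S. real (card (cycles (u \<circ> p) S))) =
    - real (card (full_cycles S)) * shifted_integral (pA * cycle_prod cycle_poly p S)"
  using assms
proof (induction "card S" arbitrary: S p rule: less_induct)
  case less
  note S = \<open>finite S\<close> and p = \<open>p permutes S\<close>
  show ?case
  proof (cases "\<exists>z\<in>S. p z \<noteq> z")
    \<comment> \<open>Base case: \<open>p\<close> is the identity, every product is a full cycle,
      and the integral of \<open>pA\<close> is -1.\<close>
    case False
    then have id: "p = id" using p by (auto simp: fun_eq_iff permutes_def)
    have o: "orbit id x = {x}" for x :: 'a by (simp add: orbit_eq_singleton_iff)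
    have "cycle_prod cycle_poly p S = 1"
      unfolding cycle_prod_def by (rule prod.neutral) (auto simp: cycles_def id o cycle_poly_1[unfolded One_nat_def])
    moreover have "shifted_integral pA = -1"
      by (simp add: shifted_integral_def pA_def)
    moreover have "card (cycles (u \<circ> p) S) = 1" if "u \<in> full_cycles S" for u
      using that by (simp add: id cycles_full_cycle)
    ultimately show ?thesis by simp
  next
    case True
    then obtain z where z: "z \<in> S" "p z \<noteq> z" by blast
    have pz: "p z \<in> S - {z}" using z p by (simp add: permutes_in_image)
    let ?T = "S - {z}" and ?N = "real (card (full_cycles (S - {z})))"
    have Sz: "S \<noteq> {z}" using pz by auto
    define q where "q j = del z (Transposition.transpose z j \<circ> p)" for j
    have q: "q j permutes ?T" if "j \<in> ?T" for j
      unfolding q_def using that z(1) p by (intro del_permutes permutes_compose permutes_swap_id) auto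
    \<comment> \<open>Deleting \<open>z\<close> loses a cycle only if the transposed
      \<open>p\<close> fixes \<open>z\<close>, which happens for the single value
      \<open>j = p z\<close>.\<close>
    have card: "real (card (cycles (u \<circ> Transposition.transpose z j \<circ> p) S)) =
        real (card (cycles (u \<circ> q j) ?T)) + (if j = p z then 1 else 0)"
      if u: "u \<in> full_cycles ?T" and j: "j \<in> ?T" for u j
    proof -
      have "Transposition.transpose z j \<circ> p permutes S"
        using j z(1) p by (intro permutes_compose permutes_swap_id) auto
      moreover have "Transposition.transpose z j (p z) = z \<longleftrightarrow> j = p z"
        using z(2) by (auto simp: Transposition.transpose_def)
      ultimately show ?thesis
        using full_cycles_card_cycles_comp_del[OF S z(1) full_cycles_permutes[OF u]]
        by (simp add: comp_assoc q_def)
    qed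
    have IH: "(\<Sum>u\<in>full_cycles ?T. real (card (cycles (u \<circ> q j) ?T))) =
        - ?N * shifted_integral (pA * cycle_prod cycle_poly (q j) ?T)" if j: "j \<in> ?T" for j
      using S z(1) j by (intro less.hyps q card_Diff1_less) auto
    have "(\<Sum>u\<in>full_cycles S. real (card (cycles (u \<circ> p) S))) =
        (\<Sum>u\<in>full_cycles ?T. \<Sum>j\<in>?T. real (card (cycles (u \<circ> q j) ?T)) + (if j = p z then 1 else 0))"
      unfolding sum_full_cycles_remove[OF S z(1) Sz] by (intro sum.cong refl card)
    also have "\<dots> = (\<Sum>j\<in>?T. \<Sum>u\<in>full_cycles ?T. real (card (cycles (u \<circ> q j) ?T))) + ?N"
      using pz S by (simp add: sum.distrib sum.swap[of _ "full_cycles ?T"])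
    also have "\<dots> = - ?N * (\<Sum>j\<in>?T. shifted_integral (pA * cycle_prod cycle_poly (q j) ?T)) + ?N"
      by (simp add: IH sum_distrib_left)
    \<comment> \<open>The boundary term 1 of the recursion, multiplied by \<open>- ?N\<close>,
      cancels the \<open>?N\<close> lost cycles.\<close>
    also have "\<dots> = - (?N * real (card S - 1)) * shifted_integral (pA * cycle_prod cycle_poly p S)"
      unfolding q_def shifted_integral_cycle_prod_rec[OF p S z] by (simp add: algebra_simps)
    finally show ?thesis unfolding card_full_cycles_remove[OF S z(1) Sz] by simp
  qed
qed

section \<open>Two points in the same cycle\<close>

lemma cycle_prod_full_cycle: "u \<in> full_cycles S \<Longrightarrow> cycle_prod w u S = w (card S)"
  by (simp add: cycle_prod_def cycles_full_cycle)

lemma sum_cycle_prod_transpose_full_cycle: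
  assumes u: "u \<in> full_cycles S" and S: "finite S" and a: "a \<in> S"
  shows "(\<Sum>b\<in>S - {a}. cycle_prod w (Transposition.transpose a b \<circ> u) S) =
    (\<Sum>k=1..<card S. w k * w (card S - k))"
proof -
  have p: "u permutes S" using u by (rule full_cycles_permutes)
  have pp: "permutation u" using S p by (rule permutes_imp_permutation)
  have o: "orbit u a = S" using u a by (rule orbit_full_cycle)
  have "(\<Sum>b\<in>S - {a}. cycle_prod w (Transposition.transpose a b \<circ> u) S) =
      (\<Sum>k=1..<card S. cycle_prod w (Transposition.transpose a ((u ^^ k) a) \<circ> u) S)"
    using sum.reindex_bij_betw[OF orbit_power_bij[OF pp, of a, unfolded o], symmetric] .
  also have "\<dots> = (\<Sum>k=1..<card S. w k * w (card S - k))"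
  proof (rule sum.cong[OF refl])
    fix k assume "k \<in> {1..<card S}"
    then have k: "0 < k" "k < card (orbit u a)" by (auto simp: o)
    note s = cycles_transpose_split[OF p S a k refl]
    note d = transpose_split_disjoint(3,4)[OF pp k refl]
    show "cycle_prod w (Transposition.transpose a ((u ^^ k) a) \<circ> u) S = w k * w (card S - k)"
      using s(2) d unfolding cycle_prod_def s(1) cycles_full_cycle[OF u] o by simp
  qed
  finally show ?thesis .
qed

text \<open>Conjugation by the transposition of \<open>b\<close> and \<open>c\<close> permutes the
  full cycles, fixes \<open>a\<close> and takes \<open>b\<close> to \<open>c\<close>.\<close>

lemma sum_full_cycles_transpose_cong:
  assumes S: "finite S" and a: "a \<in> S" and b: "b \<in> S - {a}" and c: "c \<in> S - {a}"
  shows "(\<Sum>u\<in>full_cycles S. cycle_prod w (Transposition.transpose a b \<circ> u) S) =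
    (\<Sum>u\<in>full_cycles S. cycle_prod w (Transposition.transpose a c \<circ> u) S)"
proof -
  define g where "g = Transposition.transpose b c"
  have gg: "g \<circ> g = id" by (simp add: g_def)
  have g: "g permutes S" unfolding g_def using b c by (intro permutes_swap_id) auto
  have ga: "g a = a" "g b = c" using b c by (auto simp: g_def)
  have conj: "g \<circ> u \<circ> g \<in> full_cycles S" if u: "u \<in> full_cycles S" for u
  proof -
    have "cyclic_on (g \<circ> u \<circ> g) (g ` S)"
      using u fun_cong[OF gg] by (intro cyclic_on_image[of u]) (auto simp: full_cycles_def)
    then show ?thesis
      using full_cycles_permutes[OF u] g
      by (simp add: full_cycles_def permutes_image[OF g] permutes_compose)
  qed
  have inv: "g \<circ> (g \<circ> u \<circ> g) \<circ> g = u" for u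
    using fun_cong[OF gg] by (auto simp: fun_eq_iff)
  show ?thesis
  proof (rule sum.reindex_bij_witness[of _ "\<lambda>u. g \<circ> u \<circ> g" "\<lambda>u. g \<circ> u \<circ> g"])
    fix u assume u: "u \<in> full_cycles S"
    have p: "Transposition.transpose a b \<circ> u permutes S"
      using a b full_cycles_permutes[OF u] by (intro permutes_compose permutes_swap_id) auto
    have "g \<circ> Transposition.transpose a b = Transposition.transpose a c \<circ> g"
      using comp_transpose[OF permutes_bij[OF g], of a b] ga by simp
    then have "g \<circ> (Transposition.transpose a b \<circ> u) = Transposition.transpose a c \<circ> (g \<circ> u \<circ> g) \<circ> g"
      using fun_cong[OF gg] by (auto simp: fun_eq_iff)
    from cycle_prod_semiconj[OF p S g this]
    show "cycle_prod w (Transposition.transpose a c \<circ> (g \<circ> u \<circ> g)) S =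
        cycle_prod w (Transposition.transpose a b \<circ> u) S" .
  qed (use conj inv in auto)
qed

text \<open>By symmetry the sum is the same for every second point, so it may be averaged over all
  of them; for a fixed \<open>u\<close> the split length \<open>k\<close> then takes each value
  once.\<close>

lemma sum_cycle_prod_transpose_full_cycles:
  assumes S: "finite S" and a: "a \<in> S" and c: "c \<in> S - {a}"
  shows "of_nat (card S - 1) * (\<Sum>u\<in>full_cycles S. cycle_prod w (Transposition.transpose a c \<circ> u) S) =
    of_nat (card (full_cycles S)) * (\<Sum>k=1..<card S. w k * w (card S - k) :: 'b::comm_semiring_1)"
proof -
  have "of_nat (card S - 1) * (\<Sum>u\<in>full_cycles S. cycle_prod w (Transposition.transpose a c \<circ> u) S) =
      (\<Sum>b\<in>S - {a}. \<Sum>u\<in>full_cycles S. cycle_prod w (Transposition.transpose a c \<circ> u) S)"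
    using a by simp
  also have "\<dots> = (\<Sum>b\<in>S - {a}. \<Sum>u\<in>full_cycles S. cycle_prod w (Transposition.transpose a b \<circ> u) S)"
    using sum_full_cycles_transpose_cong[OF S a c] by (rule sum.cong[OF refl])
  also have "\<dots> = (\<Sum>u\<in>full_cycles S. \<Sum>b\<in>S - {a}. cycle_prod w (Transposition.transpose a b \<circ> u) S)"
    by (rule sum.swap)
  also have "\<dots> = (\<Sum>u\<in>full_cycles S. \<Sum>k=1..<card S. w k * w (card S - k))"
    by (intro sum.cong refl sum_cycle_prod_transpose_full_cycle S a)
  finally show ?thesis by simp
qed

text \<open>The summand is 1 if \<open>a\<close> and \<open>c\<close> share a cycle and -1
  otherwise, so for the \<open>n\<close>-cycles the double sum is
  \<open>2 * cycle_product_prob n - 1\<close> times the number of pairs.\<close>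

lemma same_cycle_bias:
  assumes S: "finite S" and a: "a \<in> S" and c: "c \<in> S - {a}"
  shows "real (card S - 1) * (\<Sum>u\<in>full_cycles S. \<Sum>v\<in>full_cycles S.
      2 * of_bool (c \<in> orbit (u \<circ> v) a) - 1) =
    - 2 * (1 + (-1) ^ card S) / (real (card S) + 2) * (real (card (full_cycles S)))\<^sup>2"
proof -
  let ?C = "full_cycles S" and ?n = "card S" and ?t = "Transposition.transpose a c"
  let ?I = "\<lambda>p. shifted_integral (pA * cycle_prod cycle_poly p S)"
  define N where "N = card (full_cycles S)"
  have t: "?t permutes S" using a c by (intro permutes_swap_id) auto
  have bias: "2 * of_bool (c \<in> orbit (u \<circ> v) a) - 1 =
      real (card (cycles (v \<circ> (?t \<circ> u)) S)) - real (card (cycles (v \<circ> u) S))"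
    if "u \<in> ?C" "v \<in> ?C" for u v
  proof -
    have u: "u permutes S" and v: "v permutes S" using that full_cycles_permutes by auto
    have uv: "u \<circ> v permutes S" using u v by (intro permutes_compose)
    \<comment> \<open>Cyclic rotation brings \<open>v\<close> to the front, so that the integral
      formula can be summed over \<open>v\<close> with \<open>u\<close> fixed.\<close>
    have "card (cycles (v \<circ> (?t \<circ> u)) S) = card (cycles (?t \<circ> (u \<circ> v)) S)"
      using card_cycles_comp_commute[OF v _ S, of "?t \<circ> u"] t u
      by (simp add: permutes_compose comp_assoc)
    moreover have "card (cycles (v \<circ> u) S) = card (cycles (u \<circ> v) S)"
      using v u S by (rule card_cycles_comp_commute)
    ultimately show ?thesis
      using card_cycles_transpose_split[OF uv S a, of c] cycles_transpose_merge(5)[OF uv S a, of c] c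
      by (cases "c \<in> orbit (u \<circ> v) a") auto
  qed
  have "(\<Sum>u\<in>?C. \<Sum>v\<in>?C. 2 * of_bool (c \<in> orbit (u \<circ> v) a) - 1) =
      (\<Sum>u\<in>?C. (\<Sum>v\<in>?C. real (card (cycles (v \<circ> (?t \<circ> u)) S))) - (\<Sum>v\<in>?C. real (card (cycles (v \<circ> u) S))))"
    by (simp only: sum_subtractf[symmetric]) (intro sum.cong refl bias)
  also have "\<dots> = (\<Sum>u\<in>?C. real N * (?I u - ?I (?t \<circ> u)))"
  proof (rule sum.cong[OF refl])
    fix u assume "u \<in> ?C"
    then have u: "u permutes S" by (rule full_cycles_permutes)
    then have "?t \<circ> u permutes S" using t by (rule permutes_compose)
    moreover have "S \<noteq> {}" using a by auto
    ultimately show "(\<Sum>v\<in>?C. real (card (cycles (v \<circ> (?t \<circ> u)) S))) - (\<Sum>v\<in>?C. real (card (cycles (v \<circ> u) S))) =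
        real N * (?I u - ?I (?t \<circ> u))"
      using u S by (simp add: sum_card_cycles_full_cycles_comp N_def right_diff_distrib)
  qed
  also have "\<dots> = real N * shifted_integral (pA * (of_nat N * cycle_poly ?n -
      (\<Sum>u\<in>?C. cycle_prod cycle_poly (?t \<circ> u) S)))"
    unfolding sum_distrib_left[symmetric] shifted_integral_diff[symmetric] shifted_integral_sum[symmetric]
      right_diff_distrib[symmetric] sum_subtractf
    by (simp add: cycle_prod_full_cycle N_def)
  finally have eq: "(\<Sum>u\<in>?C. \<Sum>v\<in>?C. 2 * of_bool (c \<in> orbit (u \<circ> v) a) - 1) =
      real N * shifted_integral (pA * (of_nat N * cycle_poly ?n -
      (\<Sum>u\<in>?C. cycle_prod cycle_poly (?t \<circ> u) S)))" .
  \<comment> \<open>The factor \<open>?n - 1\<close> is moved inside the polynomial, where it meets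
    the sum over \<open>u\<close> and the averaging identity applies.\<close>
  have "real (?n - 1) * (\<Sum>u\<in>?C. \<Sum>v\<in>?C. 2 * of_bool (c \<in> orbit (u \<circ> v) a) - 1) =
      real N * shifted_integral (of_nat (?n - 1) * (pA * (of_nat N * cycle_poly ?n -
      (\<Sum>u\<in>?C. cycle_prod cycle_poly (?t \<circ> u) S))))"
    unfolding eq shifted_integral_of_nat_mult by (rule mult.left_commute)
  also have "of_nat (?n - 1) * (pA * (of_nat N * cycle_poly ?n - (\<Sum>u\<in>?C. cycle_prod cycle_poly (?t \<circ> u) S)))
      = pA * (of_nat N * (of_nat (?n - 1) * cycle_poly ?n)
        - of_nat (?n - 1) * (\<Sum>u\<in>?C. cycle_prod cycle_poly (?t \<circ> u) S))"
    by (simp only: right_diff_distrib mult_ac)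
  also have "\<dots> = of_nat N * (pA * (of_nat (?n - 1) * cycle_poly ?n -
      (\<Sum>k=1..<?n. cycle_poly k * cycle_poly (?n - k))))"
    unfolding sum_cycle_prod_transpose_full_cycles[OF S a c] N_def
    by (simp only: right_diff_distrib mult_ac)
  finally show ?thesis
  proof -
    have "card {a, c} \<le> ?n" using S a c by (intro card_mono) auto
    then have "2 \<le> ?n" using c by auto
    note I = shifted_integral_split_cycle[OF this]
    assume "real (?n - 1) * (\<Sum>u\<in>?C. \<Sum>v\<in>?C. 2 * of_bool (c \<in> orbit (u \<circ> v) a) - 1) =
      real N * shifted_integral (of_nat N * (pA * (of_nat (?n - 1) * cycle_poly ?n -
      (\<Sum>k=1..<?n. cycle_poly k * cycle_poly (?n - k)))))"
    then show ?thesis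
      unfolding shifted_integral_of_nat_mult I N_def by (simp add: power2_eq_square)
  qed
qed

lemma pair_pmf_of_set:
  assumes "finite A" "A \<noteq> {}" "finite B" "B \<noteq> {}"
  shows "pair_pmf (pmf_of_set A) (pmf_of_set B) = pmf_of_set (A \<times> B)"
proof (rule pmf_eqI)
  fix x :: "'a \<times> 'b"
  show "pmf (pair_pmf (pmf_of_set A) (pmf_of_set B)) x = pmf (pmf_of_set (A \<times> B)) x"
    using assms by (cases x) (simp add: pmf_pair pmf_of_set indicator_def card_cartesian_product)
qed

theorem theorem1:
  fixes n :: nat
  assumes "n \<ge> 2"
  shows "cycle_product_prob n =
    (if odd n then 1 / 2 else 1 / 2 - 2 / ((real n - 1) * (real n + 2)))"
proof -
  let ?C = "n_cycles n"
  define same :: "((nat \<Rightarrow> nat) \<times> (nat \<Rightarrow> nat)) set" where "same = {(u, v). 2 \<in> orbit (u \<circ> v) 1}"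
  define N where "N = real (card ?C)"
  have C: "finite ?C" "?C \<noteq> {}" using finite_n_cycles n_cycles_nonempty[of n] assms by auto
  have N: "N > 0" unfolding N_def using C by (simp add: card_gt_0_iff)
  have fc: "?C = full_cycles {1..n}" by (simp add: n_cycles_def full_cycles_def)
  have "cycle_product_prob n = real (card (?C \<times> ?C \<inter> same)) / N\<^sup>2"
    unfolding cycle_product_prob_def same_def[symmetric] pair_pmf_of_set[OF C C]
    using C by (subst measure_pmf_of_set) (auto simp: N_def power2_eq_square card_cartesian_product)
  moreover have "real (card (?C \<times> ?C \<inter> same)) = (\<Sum>(u, v)\<in>?C \<times> ?C. of_bool (2 \<in> orbit (u \<circ> v) 1))"
    using C by (simp add: of_bool_def sum.If_cases case_prod_beta same_def Int_def conj_commute)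
  ultimately have P: "(\<Sum>u\<in>?C. \<Sum>v\<in>?C. of_bool (2 \<in> orbit (u \<circ> v) 1)) = cycle_product_prob n * N\<^sup>2"
    using N by (simp add: sum.cartesian_product)
  have "(real n - 1) * (\<Sum>u\<in>?C. \<Sum>v\<in>?C. 2 * of_bool (2 \<in> orbit (u \<circ> v) 1) - 1) =
      - 2 * (1 + (-1) ^ n) / (real n + 2) * N\<^sup>2"
    using same_cycle_bias[of "{1..n}" 1 2] assms unfolding fc N_def by (simp add: of_nat_diff)
  also have "(\<Sum>u\<in>?C. \<Sum>v\<in>?C. 2 * of_bool (2 \<in> orbit (u \<circ> v) 1) - 1) = (2 * cycle_product_prob n - 1) * N\<^sup>2"
    by (simp add: sum_subtractf sum_distrib_left[symmetric] P[unfolded One_nat_def] N_def power2_eq_square algebra_simps)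
  finally have "(real n - 1) * (2 * cycle_product_prob n - 1) * N\<^sup>2 =
      - 2 * (1 + (-1) ^ n) / (real n + 2) * N\<^sup>2"
    by (simp only: mult.assoc)
  then have eq: "(real n - 1) * (2 * cycle_product_prob n - 1) = - 2 * (1 + (-1) ^ n) / (real n + 2)"
    by (rule mult_right_cancel[THEN iffD1, rotated]) (use N in simp)
  \<comment> \<open>Applied with \<open>d = n - 1\<close>, \<open>e = n + 2\<close> and
    \<open>X = 1 + (-1) ^ n\<close>, which is 0 for odd \<open>n\<close> and 2 for even
    \<open>n\<close>.\<close>
  have solve: "c = 1 / 2 - X / (d * e)" if "d * (2 * c - 1) = - 2 * X / e" "d > 0" "e > 0" for c d e X :: real
    using that by (simp add: field_simps)
  have "cycle_product_prob n = 1 / 2 - (1 + (-1) ^ n) / ((real n - 1) * (real n + 2))"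
    by (rule solve[OF eq]) (use assms in auto)
  then show ?thesis by (cases "odd n") auto
qed

end
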